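(* Let $L$ be a bounded modular lattice and let $(a,b)$ be a complementary pair in $L$ (that is, $a\wedge b=0$ and $a\vee b=1$). Then the interval $(a,b)\!\downarrow$ of the orthomodular poset $L^{(2)}$ is isomorphic, as an orthomodular poset, to the orthomodular poset $(a\!\downarrow)^{(2)}$, where $a\!\downarrow=\{x\in L: x\leq a\}$ is regarded as a bounded modular lattice with bounds $0$ and $a$.
   Context: An orthocomplemented poset is a bounded poset $P$ with a unary operation $'$ that is of period two ($x''=x$), order inverting, and such that for each $x$ the only lower bound of $x,x'$ is $0$ and the only upper bound of $x,x'$ is $1$. An orthomodular poset (OMP) is an orthocomplemented poset such that (1) $x\leq y'$ implies $x,y$ have a least upper bound, written $x\oplus y$; and (2) $x\leq y$ implies $x\oplus(x\oplus y')'=y$. For a bounded modular lattice $M$, $M^{(2)}$ denotes the set of all ordered pairs $(x_1,x_2)$ of complementary elements of $M$, with $(x_1,x_2)\leq(y_1,y_2)$ iff $x_1\leq y_1$ and $y_2\leq x_2$, and $(x_1,x_2)'=(x_2,x_1)$. It is known that $M^{(2)}$ is an OMP. For an element $p$ of an OMP $P$, the interval $p\!\downarrow=\{q\in P: q\leq p\}$ is an OMP under the induced partial order and the orthocomplementation $q^{\#}=p\wedge q'$ (this greatest lower bound exists in $P$). An isomorphism of OMPs is an order isomorphism that is compatible with the orthocomplementations. *)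

theory Defs
  imports "HOL-Algebra.Lattice"
begin

section \<open>Bounded modular lattices\<close>

locale bounded_modular_lattice = bounded_lattice L for L (structure) +
  assumes modular:
    "\<lbrakk>x \<in> carrier L; y \<in> carrier L; z \<in> carrier L; x \<sqsubseteq> z\<rbrakk>
      \<Longrightarrow> x \<squnion> (y \<sqinter> z) = (x \<squnion> y) \<sqinter> z"

definition complementary :: "('a, 'c) gorder_scheme \<Rightarrow> 'a \<Rightarrow> 'a \<Rightarrow> bool" where
  "complementary L x y \<longleftrightarrow>
     x \<in> carrier L \<and> y \<in> carrier L \<and> x \<sqinter>\<^bsub>L\<^esub> y = \<bottom>\<^bsub>L\<^esub> \<and> x \<squnion>\<^bsub>L\<^esub> y = \<top>\<^bsub>L\<^esub>"

text \<open>The bounds and the lattice operations of the result are those of the restricted order;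
  in particular complements in it are relative to its own top, which is \<open>a\<close>.\<close>

definition down :: "('a, 'c) gorder_scheme \<Rightarrow> 'a \<Rightarrow> ('a, 'c) gorder_scheme" where
  "down L a = L\<lparr>carrier := {x \<in> carrier L. x \<sqsubseteq>\<^bsub>L\<^esub> a}\<rparr>"


section \<open>Orthomodular posets\<close>

record 'a ortho_poset = "'a gorder" +
  ocompl :: "'a \<Rightarrow> 'a" (\<open>\<sim>\<index> _\<close> [81] 80)

locale orthocomplemented_poset =
  partial_order P + weak_partial_order_bottom P + weak_partial_order_top P
  for P (structure) +
  assumes ocompl_closed: "x \<in> carrier P \<Longrightarrow> \<sim> x \<in> carrier P"
    and ocompl_ocompl: "x \<in> carrier P \<Longrightarrow> \<sim> (\<sim> x) = x"
    and ocompl_antimono: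
      "\<lbrakk>x \<in> carrier P; y \<in> carrier P; x \<sqsubseteq> y\<rbrakk> \<Longrightarrow> \<sim> y \<sqsubseteq> \<sim> x"
    and Lower_ocompl: "x \<in> carrier P \<Longrightarrow> Lower P {x, \<sim> x} = {\<bottom>}"
    and Upper_ocompl: "x \<in> carrier P \<Longrightarrow> Upper P {x, \<sim> x} = {\<top>}"

text \<open>The operation \<open>\<oplus>\<close> is \<^const>\<open>join\<close>, which is meaningful only where the least
  upper bound exists; both joins in \<open>orthomodular\<close> are of the kind
  provided by \<open>orthogonal_lub_exists\<close>.\<close>

locale orthomodular_poset = orthocomplemented_poset +
  assumes orthogonal_lub_exists:
      "\<lbrakk>x \<in> carrier P; y \<in> carrier P; x \<sqsubseteq> \<sim> y\<rbrakk> \<Longrightarrow> \<exists>s. is_lub P s {x, y}"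
    and orthomodular:
      "\<lbrakk>x \<in> carrier P; y \<in> carrier P; x \<sqsubseteq> y\<rbrakk> \<Longrightarrow> x \<squnion> \<sim> (x \<squnion> \<sim> y) = y"

definition omp_interval ::
    "('a, 'c) ortho_poset_scheme \<Rightarrow> 'a \<Rightarrow> ('a, 'c) ortho_poset_scheme" where
  "omp_interval P p =
     P\<lparr>carrier := {q \<in> carrier P. q \<sqsubseteq>\<^bsub>P\<^esub> p}, ocompl := (\<lambda>q. p \<sqinter>\<^bsub>P\<^esub> \<sim>\<^bsub>P\<^esub> q)\<rparr>"

definition complementary_pairs :: "('a, 'c) gorder_scheme \<Rightarrow> ('a \<times> 'a) ortho_poset" where
  "complementary_pairs M =
     \<lparr>carrier = {(x1, x2). complementary M x1 x2},
      eq = (=),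
      le = (\<lambda>(x1, x2) (y1, y2). x1 \<sqsubseteq>\<^bsub>M\<^esub> y1 \<and> y2 \<sqsubseteq>\<^bsub>M\<^esub> x2),
      ocompl = (\<lambda>(x1, x2). (x2, x1))\<rparr>"

text \<open>Being an isomorphism of orthomodular posets includes that both sides are orthomodular
  posets.\<close>

definition omp_iso ::
    "('a, 'c) ortho_poset_scheme \<Rightarrow> ('b, 'd) ortho_poset_scheme \<Rightarrow> ('a \<Rightarrow> 'b) set" where
  "omp_iso P Q =
     {h. orthomodular_poset P \<and> orthomodular_poset Q \<and>
         bij_betw h (carrier P) (carrier Q) \<and>
         (\<forall>x \<in> carrier P. \<forall>y \<in> carrier P. x \<sqsubseteq>\<^bsub>P\<^esub> y \<longleftrightarrow> h x \<sqsubseteq>\<^bsub>Q\<^esub> h y) \<and>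
         (\<forall>x \<in> carrier P. h (\<sim>\<^bsub>P\<^esub> x) = \<sim>\<^bsub>Q\<^esub> (h x))}"

definition omp_isomorphic ::
    "('a, 'c) ortho_poset_scheme \<Rightarrow> ('b, 'd) ortho_poset_scheme \<Rightarrow> bool" where
  "omp_isomorphic P Q \<longleftrightarrow> omp_iso P Q \<noteq> {}"

end

theory Submission
  imports Defs
begin

text \<open>
  Writing \<open>0\<close> and \<open>1\<close> for the bounds of \<open>L\<close>, a pair below \<open>(a, b)\<close> is a complementary pair
  \<open>(x1, x2)\<close> with \<open>x1 \<le> a\<close> and \<open>b \<le> x2\<close>. By Dedekind's transposition principle the perspective
  intervals \<open>[b, 1]\<close> and \<open>[0, a]\<close> are isomorphic through the mutually inverse maps
  \<open>z \<mapsto> z \<sqinter> a\<close> and \<open>v \<mapsto> v \<squnion> b\<close>. Applying this to the second component turns a complement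
  \<open>x2\<close> of \<open>x1\<close> in \<open>L\<close> into the complement \<open>x2 \<sqinter> a\<close> of \<open>x1\<close> relative to \<open>a\<close>, and conversely, so
  that \<open>(x1, x2) \<mapsto> (x1, x2 \<sqinter> a)\<close> is an order isomorphism (\<open>restrict_pair_bij\<close>,
  \<open>restrict_pair_le_iff\<close>).

  For the orthocomplementation one has to know the meet of \<open>(a, b)\<close> with \<open>(x2, x1)\<close>. Modularity
  makes the componentwise meet \<open>(a \<sqinter> x2, b \<squnion> x1)\<close> a complementary pair, and then it is the
  greatest lower bound; it is sent to \<open>(a \<sqinter> x2, x1)\<close>, the swap of the image of \<open>(x1, x2)\<close>
  (\<open>restrict_pair_ocompl\<close>).

  The complementary pairs of any bounded modular lattice form an orthomodular poset
  (\<open>complementary_pairs_orthomodular\<close>), again because joins of orthogonal pairs are componentwise.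
  This applies to \<open>down L a\<close>; that the interval below \<open>(a, b)\<close> is orthomodular too then follows by
  transport along the isomorphism (\<open>orthomodular_poset_transport\<close>).
\<close>

section \<open>Transport of orthomodularity along isomorphisms\<close>

lemma (in partial_order) join_eqI:
  assumes "is_lub L s {x, y}"
  shows "x \<squnion> y = s"
  unfolding join_def Lattice.sup_def
  by (rule someI2, rule assms) (rule least_unique[OF _ assms])

lemma (in partial_order) meet_eqI:
  assumes "is_glb L i {x, y}"
  shows "x \<sqinter> y = i"
  unfolding meet_def Lattice.inf_def
  by (rule someI2, rule assms) (rule greatest_unique[OF _ assms])

lemma Lower_eq_bottomI:
  fixes P (structure)
  assumes "partial_order P" "weak_partial_order_bottom P" and glb: "is_glb P \<bottom> A"
  shows "Lower P A = {\<bottom>}"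
proof -
  interpret partial_order P by fact
  interpret weak_partial_order_bottom P by fact
  have "l = \<bottom>" if "l \<in> Lower P A" for l
    using greatest_le[OF glb that] subsetD[OF Lower_closed that] by (intro le_antisym) auto
  then show ?thesis
    using greatest_mem[OF glb] by blast
qed

lemma Upper_eq_topI:
  fixes P (structure)
  assumes "partial_order P" "weak_partial_order_top P" and lub: "is_lub P \<top> A"
  shows "Upper P A = {\<top>}"
proof -
  interpret partial_order P by fact
  interpret weak_partial_order_top P by fact
  have "u = \<top>" if "u \<in> Upper P A" for u
    using least_le[OF lub that] subsetD[OF Upper_closed that] by (intro le_antisym) auto
  then show ?thesis
    using least_mem[OF lub] by blast
qed

text \<open>Nothing is assumed of the two relations themselves, so that \<open>P\<close> can be shown to be an order
  by pulling the order axioms back from \<open>Q\<close>.\<close>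

locale order_isomorphism =
  fixes P :: "('a, 'c) gorder_scheme" and Q :: "('b, 'd) gorder_scheme" and h :: "'a \<Rightarrow> 'b"
  assumes bij: "bij_betw h (carrier P) (carrier Q)"
    and le_iff: "\<And>x y. x \<in> carrier P \<Longrightarrow> y \<in> carrier P \<Longrightarrow> x \<sqsubseteq>\<^bsub>P\<^esub> y \<longleftrightarrow> h x \<sqsubseteq>\<^bsub>Q\<^esub> h y"
begin

lemma image_Upper_iso:
  assumes "A \<subseteq> carrier P"
  shows "h ` Upper P A = Upper Q (h ` A)"
proof -
  have Q: "carrier Q = h ` carrier P"
    using bij by (simp add: bij_betw_def)
  have "Upper P A = {u \<in> carrier P. \<forall>x\<in>A. x \<sqsubseteq>\<^bsub>P\<^esub> u}"
    using assms by (auto simp: Upper_def)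
  moreover have "Upper Q (h ` A) = {u \<in> carrier Q. \<forall>x\<in>A. h x \<sqsubseteq>\<^bsub>Q\<^esub> u}"
    using assms unfolding Upper_def Q by blast
  ultimately show ?thesis
    using assms le_iff unfolding Q by (auto simp: subset_iff)
qed

lemma image_Lower_iso:
  assumes "A \<subseteq> carrier P"
  shows "h ` Lower P A = Lower Q (h ` A)"
proof -
  have Q: "carrier Q = h ` carrier P"
    using bij by (simp add: bij_betw_def)
  have "Lower P A = {l \<in> carrier P. \<forall>x\<in>A. l \<sqsubseteq>\<^bsub>P\<^esub> x}"
    using assms by (auto simp: Lower_def)
  moreover have "Lower Q (h ` A) = {l \<in> carrier Q. \<forall>x\<in>A. l \<sqsubseteq>\<^bsub>Q\<^esub> h x}"
    using assms unfolding Lower_def Q by blast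
  ultimately show ?thesis
    using assms le_iff unfolding Q by (auto simp: subset_iff)
qed

lemma least_iso_iff:
  assumes "X \<subseteq> carrier P" "s \<in> carrier P"
  shows "least P s X \<longleftrightarrow> least Q (h s) (h ` X)"
proof -
  have "h ` X \<subseteq> carrier Q"
    using assms bij by (auto simp: bij_betw_def)
  moreover have "h s \<in> h ` X \<longleftrightarrow> s \<in> X"
    using bij assms by (intro inj_on_image_mem_iff) (auto simp: bij_betw_def)
  moreover have "h s \<sqsubseteq>\<^bsub>Q\<^esub> h x \<longleftrightarrow> s \<sqsubseteq>\<^bsub>P\<^esub> x" if "x \<in> X" for x
    using that assms le_iff by blast
  ultimately show ?thesis
    using assms(1) by (simp add: least_def)
qed

lemma greatest_iso_iff:
  assumes "X \<subseteq> carrier P" "s \<in> carrier P"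
  shows "greatest P s X \<longleftrightarrow> greatest Q (h s) (h ` X)"
proof -
  have "h ` X \<subseteq> carrier Q"
    using assms bij by (auto simp: bij_betw_def)
  moreover have "h s \<in> h ` X \<longleftrightarrow> s \<in> X"
    using bij assms by (intro inj_on_image_mem_iff) (auto simp: bij_betw_def)
  moreover have "h x \<sqsubseteq>\<^bsub>Q\<^esub> h s \<longleftrightarrow> x \<sqsubseteq>\<^bsub>P\<^esub> s" if "x \<in> X" for x
    using that assms le_iff by blast
  ultimately show ?thesis
    using assms(1) by (simp add: greatest_def)
qed

lemma is_lub_iso_iff:
  assumes "x \<in> carrier P" "y \<in> carrier P" "s \<in> carrier P"
  shows "is_lub P s {x, y} \<longleftrightarrow> is_lub Q (h s) {h x, h y}"
  using least_iso_iff[OF Upper_closed assms(3)] image_Upper_iso[of "{x, y}"] assms by simp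

lemma partial_order_iso:
  assumes "partial_order Q" and eq: "eq P = (=)"
  shows "partial_order P"
proof -
  interpret Q: partial_order Q by fact
  have inj: "inj_on h (carrier P)" and cl: "\<And>x. x \<in> carrier P \<Longrightarrow> h x \<in> carrier Q"
    using bij by (auto simp: bij_betw_def)
  show ?thesis
  proof unfold_locales
    show "x \<sqsubseteq>\<^bsub>P\<^esub> z" if "x \<sqsubseteq>\<^bsub>P\<^esub> y" "y \<sqsubseteq>\<^bsub>P\<^esub> z"
      "x \<in> carrier P" "y \<in> carrier P" "z \<in> carrier P" for x y z
      using that Q.le_trans[of "h x" "h y" "h z"] by (simp add: le_iff cl)
    show "x .=\<^bsub>P\<^esub> y" if "x \<sqsubseteq>\<^bsub>P\<^esub> y" "y \<sqsubseteq>\<^bsub>P\<^esub> x" "x \<in> carrier P" "y \<in> carrier P" for x y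
      using that Q.le_antisym[of "h x" "h y"] inj by (simp add: le_iff cl eq inj_on_eq_iff)
  qed (simp_all add: eq le_iff cl)
qed

end

text \<open>Closure of \<open>P\<close> under orthocomplementation is assumed because \<open>h\<close>, which is injective only on
  the carrier, cannot detect it: \<open>h (\<sim> x) \<in> carrier Q\<close> says nothing about \<open>\<sim> x\<close>.\<close>

lemma orthomodular_poset_transport:
  fixes P :: "('a, 'c) ortho_poset_scheme" and Q :: "('b, 'd) ortho_poset_scheme"
  assumes "orthomodular_poset Q"
    and eq: "eq P = (=)"
    and bij: "bij_betw h (carrier P) (carrier Q)"
    and le_iff: "\<And>x y. x \<in> carrier P \<Longrightarrow> y \<in> carrier P \<Longrightarrow> x \<sqsubseteq>\<^bsub>P\<^esub> y \<longleftrightarrow> h x \<sqsubseteq>\<^bsub>Q\<^esub> h y"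
    and closed: "\<And>x. x \<in> carrier P \<Longrightarrow> \<sim>\<^bsub>P\<^esub> x \<in> carrier P"
    and hom: "\<And>x. x \<in> carrier P \<Longrightarrow> h (\<sim>\<^bsub>P\<^esub> x) = \<sim>\<^bsub>Q\<^esub> (h x)"
  shows "orthomodular_poset P"
proof -
  interpret Q: orthomodular_poset Q by (rule assms(1))
  interpret iso: order_isomorphism P Q h
    by (rule order_isomorphism.intro[OF bij]) (rule le_iff)
  interpret P: partial_order P
    by (rule iso.partial_order_iso[OF Q.partial_order_axioms eq])
  have inj: "inj_on h (carrier P)" and surj: "h ` carrier P = carrier Q"
    using bij by (auto simp: bij_betw_def)
  have cl: "h x \<in> carrier Q" if "x \<in> carrier P" for x
    using that by (simp flip: surj)
  have preimage: "\<exists>x\<in>carrier P. h x = z" if "z \<in> carrier Q" for z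
    using that by (auto simp flip: surj)
  obtain z where z: "z \<in> carrier P" "h z = \<bottom>\<^bsub>Q\<^esub>"
    using preimage[OF Q.bottom_closed] by blast
  have z_least: "least P z (carrier P)"
    using Q.bottom_least by (simp add: iso.least_iso_iff surj z)
  obtain t where t: "t \<in> carrier P" "h t = \<top>\<^bsub>Q\<^esub>"
    using preimage[OF Q.top_closed] by blast
  have t_greatest: "greatest P t (carrier P)"
    using Q.top_greatest by (simp add: iso.greatest_iso_iff surj t)
  interpret P: weak_partial_order_bottom P
    by unfold_locales (use z_least in blast)
  interpret P: weak_partial_order_top P
    by unfold_locales (use t_greatest in blast)
  have bottom: "h \<bottom>\<^bsub>P\<^esub> = \<bottom>\<^bsub>Q\<^esub>"
    using P.least_unique[OF P.bottom_least z_least] z by simp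
  have top: "h \<top>\<^bsub>P\<^esub> = \<top>\<^bsub>Q\<^esub>"
    using P.greatest_unique[OF P.top_greatest t_greatest] t by simp
  have lub: "\<exists>s\<in>carrier P. is_lub P s {x, y} \<and> x \<squnion>\<^bsub>P\<^esub> y = s \<and> h s = h x \<squnion>\<^bsub>Q\<^esub> h y"
    if xy: "x \<in> carrier P" "y \<in> carrier P" "x \<sqsubseteq>\<^bsub>P\<^esub> \<sim>\<^bsub>P\<^esub> y" for x y
  proof -
    have "h x \<sqsubseteq>\<^bsub>Q\<^esub> \<sim>\<^bsub>Q\<^esub> (h y)"
      using xy by (simp add: le_iff closed hom)
    then obtain z where z: "is_lub Q z {h x, h y}"
      using Q.orthogonal_lub_exists[OF cl[OF xy(1)] cl[OF xy(2)]] by blast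
    then obtain s where s: "s \<in> carrier P" "h s = z"
      using preimage[OF least_closed[OF z]] by blast
    have "is_lub P s {x, y}"
      using z s xy iso.is_lub_iso_iff[of x y s] by simp
    moreover from this have "x \<squnion>\<^bsub>P\<^esub> y = s"
      by (rule P.join_eqI)
    moreover have "h s = h x \<squnion>\<^bsub>Q\<^esub> h y"
      using Q.join_eqI[OF z] s by simp
    ultimately show ?thesis
      using s(1) by blast
  qed
  show ?thesis
  proof unfold_locales
    show "\<sim>\<^bsub>P\<^esub> x \<in> carrier P" if "x \<in> carrier P" for x
      using that by (rule closed)
    show invol: "\<sim>\<^bsub>P\<^esub> (\<sim>\<^bsub>P\<^esub> x) = x" if "x \<in> carrier P" for x
      using that Q.ocompl_ocompl[OF cl] by (intro inj_onD[OF inj]) (simp_all add: hom closed)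
    show "\<sim>\<^bsub>P\<^esub> y \<sqsubseteq>\<^bsub>P\<^esub> \<sim>\<^bsub>P\<^esub> x" if "x \<in> carrier P" "y \<in> carrier P" "x \<sqsubseteq>\<^bsub>P\<^esub> y" for x y
      using that Q.ocompl_antimono[of "h x" "h y"] by (simp add: le_iff closed hom cl)
    show "Lower P {x, \<sim>\<^bsub>P\<^esub> x} = {\<bottom>\<^bsub>P\<^esub>}" if x: "x \<in> carrier P" for x
    proof -
      have "h ` Lower P {x, \<sim>\<^bsub>P\<^esub> x} = h ` {\<bottom>\<^bsub>P\<^esub>}"
        using x iso.image_Lower_iso[of "{x, \<sim>\<^bsub>P\<^esub> x}"]
        by (simp add: closed hom bottom Q.Lower_ocompl cl)
      then show ?thesis
        by (subst (asm) inj_on_image_eq_iff[OF inj]) auto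
    qed
    show "Upper P {x, \<sim>\<^bsub>P\<^esub> x} = {\<top>\<^bsub>P\<^esub>}" if x: "x \<in> carrier P" for x
    proof -
      have "h ` Upper P {x, \<sim>\<^bsub>P\<^esub> x} = h ` {\<top>\<^bsub>P\<^esub>}"
        using x iso.image_Upper_iso[of "{x, \<sim>\<^bsub>P\<^esub> x}"]
        by (simp add: closed hom top Q.Upper_ocompl cl)
      then show ?thesis
        by (subst (asm) inj_on_image_eq_iff[OF inj]) auto
    qed
    show "\<exists>s. is_lub P s {x, y}"
      if "x \<in> carrier P" "y \<in> carrier P" "x \<sqsubseteq>\<^bsub>P\<^esub> \<sim>\<^bsub>P\<^esub> y" for x y
      using lub[OF that] by blast
    show "x \<squnion>\<^bsub>P\<^esub> \<sim>\<^bsub>P\<^esub> (x \<squnion>\<^bsub>P\<^esub> \<sim>\<^bsub>P\<^esub> y) = y"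
      if xy: "x \<in> carrier P" "y \<in> carrier P" "x \<sqsubseteq>\<^bsub>P\<^esub> y" for x y
    proof -
      obtain s where s: "s \<in> carrier P" "is_lub P s {x, \<sim>\<^bsub>P\<^esub> y}" "x \<squnion>\<^bsub>P\<^esub> \<sim>\<^bsub>P\<^esub> y = s"
          "h s = h x \<squnion>\<^bsub>Q\<^esub> h (\<sim>\<^bsub>P\<^esub> y)"
        using lub[of x "\<sim>\<^bsub>P\<^esub> y"] xy closed invol by auto
      have "x \<sqsubseteq>\<^bsub>P\<^esub> s"
        using least_Upper_above[OF s(2)] xy closed by auto
      then obtain u where u: "u \<in> carrier P" "x \<squnion>\<^bsub>P\<^esub> \<sim>\<^bsub>P\<^esub> s = u" "h u = h x \<squnion>\<^bsub>Q\<^esub> h (\<sim>\<^bsub>P\<^esub> s)"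
        using lub[of x "\<sim>\<^bsub>P\<^esub> s"] xy s(1) closed invol by auto
      have "h u = h y"
        using u(3) s(1,4) xy Q.orthomodular[of "h x" "h y"] by (simp add: hom le_iff cl)
      then have "u = y"
        using inj u(1) xy by (simp add: inj_on_eq_iff)
      then show ?thesis
        using s(3) u(2) by simp
    qed
  qed
qed

section \<open>Complementary pairs of a bounded modular lattice\<close>

context bounded_modular_lattice
begin

abbreviation pairs :: "('a \<times> 'a) ortho_poset" where
  "pairs \<equiv> complementary_pairs L"

lemma join_assoc:
  "\<lbrakk>x \<in> carrier L; y \<in> carrier L; z \<in> carrier L\<rbrakk> \<Longrightarrow> (x \<squnion> y) \<squnion> z = x \<squnion> (y \<squnion> z)"
  using weak_join_assoc by (simp add: eq_is_equal)

lemma meet_assoc: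
  "\<lbrakk>x \<in> carrier L; y \<in> carrier L; z \<in> carrier L\<rbrakk> \<Longrightarrow> (x \<sqinter> y) \<sqinter> z = x \<sqinter> (y \<sqinter> z)"
  using weak_meet_assoc by (simp add: eq_is_equal)

lemma meet_absorb1: "\<lbrakk>x \<sqsubseteq> y; x \<in> carrier L; y \<in> carrier L\<rbrakk> \<Longrightarrow> x \<sqinter> y = x"
  by (metis le_iff_join)

lemma bottom_join_eq: "x \<in> carrier L \<Longrightarrow> \<bottom> \<squnion> x = x"
  using bottom_join by (simp add: eq_is_equal)

lemma top_meet_eq: "x \<in> carrier L \<Longrightarrow> \<top> \<sqinter> x = x"
  using top_meet by (simp add: eq_is_equal)

lemma complementaryD:
  assumes "complementary L x y"
  shows "x \<in> carrier L" "y \<in> carrier L" "x \<sqinter> y = \<bottom>" "x \<squnion> y = \<top>"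
  using assms by (simp_all add: complementary_def)

lemma complementary_sym: "complementary L x y \<Longrightarrow> complementary L y x"
  by (simp add: complementary_def join_comm[of L y x] meet_comm[of L y x])

text \<open>The next two lemmas are the modular law for a triple containing a complementary pair. The first gives \<open>v \<squnion> (y \<sqinter> x) = v \<squnion> 0\<close>, the second
  \<open>(x \<squnion> y) \<sqinter> v = 1 \<sqinter> v\<close>. Together they express that taking the join with \<open>y\<close> and the meet with
  \<open>x\<close> are inverse to each other between \<open>[0, x]\<close> and \<open>[y, 1]\<close>.\<close>

lemma complementary_meet_join:
  assumes "complementary L x y" "v \<sqsubseteq> x" "v \<in> carrier L"
  shows "(v \<squnion> y) \<sqinter> x = v"
proof -
  note xy = complementaryD[OF assms(1)]
  have "(v \<squnion> y) \<sqinter> x = v \<squnion> (y \<sqinter> x)"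
    using modular[of v y x] assms xy by simp
  also have "\<dots> = v"
    using xy assms bottom_join_eq by (simp add: meet_comm[of L y x] join_comm[of L v])
  finally show ?thesis .
qed

lemma complementary_join_meet:
  assumes "complementary L x y" "x \<sqsubseteq> v" "v \<in> carrier L"
  shows "x \<squnion> (y \<sqinter> v) = v"
  using modular[of x y v] assms complementaryD[OF assms(1)] top_meet_eq by simp

text \<open>The hypotheses \<open>le\<close> say that \<open>(x1, x2)\<close> and \<open>(y1, y2)\<close> are orthogonal. They let modularity
  absorb one pair at a time: \<open>(x1 \<squnion> y1) \<sqinter> x2\<close> collapses to \<open>y1\<close>, and \<open>y1 \<squnion> (x2 \<sqinter> y2)\<close> to \<open>x2\<close>.\<close>

lemma complementary_orthogonal_join:
  assumes x: "complementary L x1 x2" and y: "complementary L y1 y2"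
    and le: "x1 \<sqsubseteq> y2" "y1 \<sqsubseteq> x2"
  shows "complementary L (x1 \<squnion> y1) (x2 \<sqinter> y2)"
proof -
  note [simp] = complementaryD[OF x] complementaryD[OF y]
  have "(y1 \<squnion> x1) \<sqinter> x2 = y1"
    using complementary_meet_join[OF complementary_sym[OF x] le(2)] by simp
  then have "(x1 \<squnion> y1) \<sqinter> (x2 \<sqinter> y2) = \<bottom>"
    using meet_assoc[of "x1 \<squnion> y1" x2 y2] by (simp add: join_comm[of L x1 y1])
  moreover have "y1 \<squnion> (x2 \<sqinter> y2) = x2"
    using complementary_join_meet[OF y le(2)] by (simp add: meet_comm[of L x2 y2])
  then have "(x1 \<squnion> y1) \<squnion> (x2 \<sqinter> y2) = \<top>"
    using join_assoc[of x1 y1 "x2 \<sqinter> y2"] by simp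
  ultimately show ?thesis
    by (simp add: complementary_def)
qed

lemma carrier_pairs [simp]: "(x, y) \<in> carrier pairs \<longleftrightarrow> complementary L x y"
  by (simp add: complementary_pairs_def)

lemma le_pairs [simp]: "(x1, x2) \<sqsubseteq>\<^bsub>pairs\<^esub> (y1, y2) \<longleftrightarrow> x1 \<sqsubseteq> y1 \<and> y2 \<sqsubseteq> x2"
  by (simp add: complementary_pairs_def)

lemma eq_pairs: "eq pairs = (=)"
  by (simp add: complementary_pairs_def)

lemma ocompl_pairs [simp]: "\<sim>\<^bsub>pairs\<^esub> (x, y) = (y, x)"
  by (simp add: complementary_pairs_def)

lemma partial_order_pairs: "partial_order pairs"
proof unfold_locales
  show "x \<sqsubseteq>\<^bsub>pairs\<^esub> z" if "x \<sqsubseteq>\<^bsub>pairs\<^esub> y" "y \<sqsubseteq>\<^bsub>pairs\<^esub> z"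
    "x \<in> carrier pairs" "y \<in> carrier pairs" "z \<in> carrier pairs" for x y z
    using that le_trans[of "fst x" "fst y" "fst z"] le_trans[of "snd z" "snd y" "snd x"]
    by (cases x; cases y; cases z) (simp add: complementary_def)
  show "x .=\<^bsub>pairs\<^esub> y" if "x \<sqsubseteq>\<^bsub>pairs\<^esub> y" "y \<sqsubseteq>\<^bsub>pairs\<^esub> x"
    "x \<in> carrier pairs" "y \<in> carrier pairs" for x y
    using that by (cases x; cases y) (auto simp: eq_pairs dest: complementaryD)
  show "x \<sqsubseteq>\<^bsub>pairs\<^esub> x" if "x \<in> carrier pairs" for x
    using that by (cases x) (auto dest: complementaryD)
qed (auto simp: eq_pairs)

lemma is_lub_pairs:
  assumes x: "complementary L x1 x2" and y: "complementary L y1 y2"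
    and le: "x1 \<sqsubseteq> y2" "y1 \<sqsubseteq> x2"
  shows "is_lub pairs (x1 \<squnion> y1, x2 \<sqinter> y2) {(x1, x2), (y1, y2)}"
proof (rule least_UpperI)
  note [simp] = complementaryD[OF x] complementaryD[OF y]
  show "p \<sqsubseteq>\<^bsub>pairs\<^esub> (x1 \<squnion> y1, x2 \<sqinter> y2)" if "p \<in> {(x1, x2), (y1, y2)}" for p
    using that by (auto simp: join_left join_right meet_left meet_right)
  show "(x1 \<squnion> y1, x2 \<sqinter> y2) \<sqsubseteq>\<^bsub>pairs\<^esub> p" if "p \<in> Upper pairs {(x1, x2), (y1, y2)}" for p
    using that x y
    by (cases p) (auto simp: Upper_def intro!: join_le meet_le dest: complementaryD)
qed (use x y complementary_orthogonal_join[OF assms] in auto)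

text \<open>The meet is the swap of the join of the swapped pairs, which \<open>le\<close> makes orthogonal.\<close>

lemma is_glb_pairs:
  assumes x: "complementary L x1 x2" and y: "complementary L y1 y2"
    and le: "x2 \<sqsubseteq> y1" "y2 \<sqsubseteq> x1"
  shows "is_glb pairs (x1 \<sqinter> y1, x2 \<squnion> y2) {(x1, x2), (y1, y2)}"
proof (rule greatest_LowerI)
  note [simp] = complementaryD[OF x] complementaryD[OF y]
  show "(x1 \<sqinter> y1, x2 \<squnion> y2) \<sqsubseteq>\<^bsub>pairs\<^esub> p" if "p \<in> {(x1, x2), (y1, y2)}" for p
    using that by (auto simp: join_left join_right meet_left meet_right)
  show "p \<sqsubseteq>\<^bsub>pairs\<^esub> (x1 \<sqinter> y1, x2 \<squnion> y2)" if "p \<in> Lower pairs {(x1, x2), (y1, y2)}" for p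
    using that x y
    by (cases p) (auto simp: Lower_def intro!: join_le meet_le dest: complementaryD)
  have "complementary L (x2 \<squnion> y2) (x1 \<sqinter> y1)"
    using complementary_orthogonal_join[OF complementary_sym[OF x] complementary_sym[OF y] le] .
  then show "(x1 \<sqinter> y1, x2 \<squnion> y2) \<in> carrier pairs"
    by (simp add: complementary_sym)
qed (use x y in auto)

lemmas join_pairs = partial_order.join_eqI[OF partial_order_pairs is_lub_pairs]

lemmas meet_pairs = partial_order.meet_eqI[OF partial_order_pairs is_glb_pairs]

lemma bottom_pairs_least: "least pairs (\<bottom>, \<top>) (carrier pairs)"
  using bottom_join_eq[of "\<top>"] top_meet_eq[of "\<bottom>"] meet_comm[of L "\<bottom>" "\<top>"]
  by (auto simp: least_def complementary_def)

lemma top_pairs_greatest: "greatest pairs (\<top>, \<bottom>) (carrier pairs)"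
  using bottom_join_eq[of "\<top>"] top_meet_eq[of "\<bottom>"] join_comm[of L "\<bottom>" "\<top>"]
  by (auto simp: greatest_def complementary_def)

lemma complementary_pairs_orthomodular: "orthomodular_poset pairs"
proof -
  interpret P: partial_order pairs by (rule partial_order_pairs)
  interpret P: weak_partial_order_bottom pairs
    by unfold_locales (use bottom_pairs_least in blast)
  interpret P: weak_partial_order_top pairs
    by unfold_locales (use top_pairs_greatest in blast)
  have bottom: "\<bottom>\<^bsub>pairs\<^esub> = (\<bottom>, \<top>)"
    by (rule P.least_unique[OF P.bottom_least bottom_pairs_least])
  have top: "\<top>\<^bsub>pairs\<^esub> = (\<top>, \<bottom>)"
    by (rule P.greatest_unique[OF P.top_greatest top_pairs_greatest])
  show ?thesis
  proof unfold_locales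
    show "\<sim>\<^bsub>pairs\<^esub> x \<in> carrier pairs" if "x \<in> carrier pairs" for x
      using that by (cases x) (simp add: complementary_sym)
    show "\<sim>\<^bsub>pairs\<^esub> (\<sim>\<^bsub>pairs\<^esub> x) = x" if "x \<in> carrier pairs" for x
      by (cases x) simp
    show "\<sim>\<^bsub>pairs\<^esub> y \<sqsubseteq>\<^bsub>pairs\<^esub> \<sim>\<^bsub>pairs\<^esub> x"
      if "x \<in> carrier pairs" "y \<in> carrier pairs" "x \<sqsubseteq>\<^bsub>pairs\<^esub> y" for x y
      using that by (cases x; cases y) simp
    \<comment> \<open>The pair \<open>x\<close> is orthogonal to its own swap, so the join and the meet of the two are
      componentwise, namely \<open>(1, 0)\<close> and \<open>(0, 1)\<close>.\<close>
    show "Lower pairs {x, \<sim>\<^bsub>pairs\<^esub> x} = {\<bottom>\<^bsub>pairs\<^esub>}" if x: "x \<in> carrier pairs" for x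
    proof -
      obtain x1 x2 where [simp]: "x = (x1, x2)" by (cases x)
      have c: "complementary L x1 x2" using x by simp
      have "is_glb pairs (x1 \<sqinter> x2, x2 \<squnion> x1) {(x1, x2), (x2, x1)}"
        using complementaryD[OF c] by (intro is_glb_pairs[OF c complementary_sym[OF c]]) auto
      then have "is_glb pairs \<bottom>\<^bsub>pairs\<^esub> {x, \<sim>\<^bsub>pairs\<^esub> x}"
        using complementaryD[OF c] by (simp add: bottom join_comm[of L x2 x1])
      then show ?thesis
        by (rule Lower_eq_bottomI[OF P.partial_order_axioms P.weak_partial_order_bottom_axioms])
    qed
    show "Upper pairs {x, \<sim>\<^bsub>pairs\<^esub> x} = {\<top>\<^bsub>pairs\<^esub>}" if x: "x \<in> carrier pairs" for x
    proof -
      obtain x1 x2 where [simp]: "x = (x1, x2)" by (cases x)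
      have c: "complementary L x1 x2" using x by simp
      have "is_lub pairs (x1 \<squnion> x2, x2 \<sqinter> x1) {(x1, x2), (x2, x1)}"
        using complementaryD[OF c] by (intro is_lub_pairs[OF c complementary_sym[OF c]]) auto
      then have "is_lub pairs \<top>\<^bsub>pairs\<^esub> {x, \<sim>\<^bsub>pairs\<^esub> x}"
        using complementaryD[OF c] by (simp add: top meet_comm[of L x2 x1])
      then show ?thesis
        by (rule Upper_eq_topI[OF P.partial_order_axioms P.weak_partial_order_top_axioms])
    qed
    show "\<exists>s. is_lub pairs s {x, y}"
      if "x \<in> carrier pairs" "y \<in> carrier pairs" "x \<sqsubseteq>\<^bsub>pairs\<^esub> \<sim>\<^bsub>pairs\<^esub> y" for x y
      using that by (cases x; cases y) (auto intro: is_lub_pairs)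
    show "x \<squnion>\<^bsub>pairs\<^esub> \<sim>\<^bsub>pairs\<^esub> (x \<squnion>\<^bsub>pairs\<^esub> \<sim>\<^bsub>pairs\<^esub> y) = y"
      if xy: "x \<in> carrier pairs" "y \<in> carrier pairs" "x \<sqsubseteq>\<^bsub>pairs\<^esub> y" for x y
    proof -
      obtain x1 x2 y1 y2 where [simp]: "x = (x1, x2)" "y = (y1, y2)" by (cases x; cases y)
      have x: "complementary L x1 x2" and y: "complementary L y1 y2"
        and le: "x1 \<sqsubseteq> y1" "y2 \<sqsubseteq> x2"
        using xy by auto
      note [simp] = complementaryD[OF x] complementaryD[OF y]
      have inner: "x \<squnion>\<^bsub>pairs\<^esub> \<sim>\<^bsub>pairs\<^esub> y = (x1 \<squnion> y2, x2 \<sqinter> y1)"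
        using join_pairs[OF x complementary_sym[OF y]] le by simp
      have "complementary L (x2 \<sqinter> y1) (x1 \<squnion> y2)"
        using complementary_orthogonal_join[OF x complementary_sym[OF y] le]
        by (rule complementary_sym)
      then have "x \<squnion>\<^bsub>pairs\<^esub> (x2 \<sqinter> y1, x1 \<squnion> y2) = (x1 \<squnion> (x2 \<sqinter> y1), x2 \<sqinter> (x1 \<squnion> y2))"
        using join_pairs[OF x] by (simp add: join_left meet_left)
      also have "x1 \<squnion> (x2 \<sqinter> y1) = y1"
        using complementary_join_meet[OF x le(1)] by simp
      also have "x2 \<sqinter> (x1 \<squnion> y2) = y2"
        using complementary_meet_join[OF complementary_sym[OF x] le(2)]
        by (simp add: meet_comm[of L x2] join_comm[of L x1])
      finally show ?thesis
        unfolding inner by simp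
    qed
  qed
qed

end

section \<open>The lattice below an element\<close>

context bounded_modular_lattice
begin

lemma carrier_down [simp]: "x \<in> carrier (down L a) \<longleftrightarrow> x \<in> carrier L \<and> x \<sqsubseteq> a"
  by (simp add: down_def)

lemma le_down [simp]: "x \<sqsubseteq>\<^bsub>down L a\<^esub> y \<longleftrightarrow> x \<sqsubseteq> y"
  by (simp add: down_def)

lemma partial_order_down: "partial_order (down L a)"
proof unfold_locales
  show "x \<sqsubseteq>\<^bsub>down L a\<^esub> z" if "x \<sqsubseteq>\<^bsub>down L a\<^esub> y" "y \<sqsubseteq>\<^bsub>down L a\<^esub> z"
    "x \<in> carrier (down L a)" "y \<in> carrier (down L a)" "z \<in> carrier (down L a)" for x y z
    using that le_trans[of x y z] by simp
qed (auto simp: down_def eq_is_equal)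

context
  fixes a
  assumes a: "a \<in> carrier L"
begin

lemma is_lub_down:
  assumes "x \<in> carrier (down L a)" "y \<in> carrier (down L a)"
  shows "is_lub (down L a) (x \<squnion> y) {x, y}"
  using assms a
  by (intro least_UpperI) (auto simp: Upper_def join_left join_right intro!: join_le)

lemma is_glb_down:
  assumes "x \<in> carrier (down L a)" "y \<in> carrier (down L a)"
  shows "is_glb (down L a) (x \<sqinter> y) {x, y}"
  using assms a le_trans[OF meet_left, of x y a]
  by (intro greatest_LowerI) (auto simp: Lower_def meet_left meet_right intro!: meet_le)

lemmas join_down = partial_order.join_eqI[OF partial_order_down is_lub_down]

lemmas meet_down = partial_order.meet_eqI[OF partial_order_down is_glb_down]

lemma bottom_down_least: "least (down L a) \<bottom> (carrier (down L a))"
  using a by (auto simp: least_def)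

lemma top_down_greatest: "greatest (down L a) a (carrier (down L a))"
  using a by (auto simp: greatest_def)

lemma bounded_lattice_down: "bounded_lattice (down L a)"
proof -
  interpret D: partial_order "down L a" by (rule partial_order_down)
  show ?thesis
    by unfold_locales
      (use is_lub_down is_glb_down bottom_down_least top_down_greatest in blast)+
qed

lemma bounded_modular_lattice_down: "bounded_modular_lattice (down L a)"
proof -
  interpret D: bounded_lattice "down L a" by (rule bounded_lattice_down)
  show ?thesis
  proof unfold_locales
    fix x y z
    assume xyz: "x \<in> carrier (down L a)" "y \<in> carrier (down L a)" "z \<in> carrier (down L a)"
      and le: "x \<sqsubseteq>\<^bsub>down L a\<^esub> z"
    have "y \<sqinter> z \<in> carrier (down L a)" "x \<squnion> y \<in> carrier (down L a)"
      using xyz D.meet_closed[of y z] D.join_closed[of x y] by (simp_all only: meet_down join_down)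
    then show "x \<squnion>\<^bsub>down L a\<^esub> (y \<sqinter>\<^bsub>down L a\<^esub> z) = (x \<squnion>\<^bsub>down L a\<^esub> y) \<sqinter>\<^bsub>down L a\<^esub> z"
      using xyz le modular[of x y z] by (simp add: meet_down join_down)
  qed
qed

lemma complementary_down_iff:
  "complementary (down L a) x y \<longleftrightarrow>
    x \<in> carrier L \<and> y \<in> carrier L \<and> x \<sqsubseteq> a \<and> y \<sqsubseteq> a \<and> x \<sqinter> y = \<bottom> \<and> x \<squnion> y = a"
proof -
  interpret D: bounded_lattice "down L a" by (rule bounded_lattice_down)
  have "\<bottom>\<^bsub>down L a\<^esub> = \<bottom>"
    by (rule D.least_unique[OF D.bottom_least bottom_down_least])
  moreover have "\<top>\<^bsub>down L a\<^esub> = a"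
    by (rule D.greatest_unique[OF D.top_greatest top_down_greatest])
  ultimately show ?thesis
    using meet_down[of x y] join_down[of x y] unfolding complementary_def by auto
qed

end

end

section \<open>The isomorphism\<close>

context bounded_modular_lattice
begin

definition restrict_pair :: "'a \<Rightarrow> 'a \<times> 'a \<Rightarrow> 'a \<times> 'a" where
  "restrict_pair a = (\<lambda>(x1, x2). (x1, x2 \<sqinter> a))"

lemma restrict_pair_simp [simp]: "restrict_pair a (x1, x2) = (x1, x2 \<sqinter> a)"
  by (simp add: restrict_pair_def)

context
  fixes a b
  assumes ab: "complementary L a b"
begin

abbreviation interval :: "('a \<times> 'a) ortho_poset" where
  "interval \<equiv> omp_interval pairs (a, b)"

lemma carrier_interval [simp]:
  "(x1, x2) \<in> carrier interval \<longleftrightarrow> complementary L x1 x2 \<and> x1 \<sqsubseteq> a \<and> b \<sqsubseteq> x2"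
  by (simp add: omp_interval_def)

lemma le_interval [simp]: "p \<sqsubseteq>\<^bsub>interval\<^esub> q \<longleftrightarrow> p \<sqsubseteq>\<^bsub>pairs\<^esub> q"
  by (simp add: omp_interval_def)

text \<open>A pair in the interval is below \<open>(a, b)\<close>, which is to say orthogonal to \<open>(b, a)\<close>; so the meet
  defining its relative orthocomplement is componentwise.\<close>

lemma ocompl_interval:
  assumes "(x1, x2) \<in> carrier interval"
  shows "\<sim>\<^bsub>interval\<^esub> (x1, x2) = (a \<sqinter> x2, b \<squnion> x1)"
proof -
  have "(a, b) \<sqinter>\<^bsub>pairs\<^esub> (x2, x1) = (a \<sqinter> x2, b \<squnion> x1)"
    using assms meet_pairs[OF ab, of x2 x1] complementary_sym by auto
  then show ?thesis
    by (simp add: omp_interval_def)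
qed

lemma ocompl_interval_closed:
  assumes "p \<in> carrier interval"
  shows "\<sim>\<^bsub>interval\<^esub> p \<in> carrier interval"
proof -
  note [simp] = complementaryD[OF ab]
  obtain x1 x2 where p: "p = (x1, x2)" by (cases p)
  have c: "complementary L x1 x2" and le: "x1 \<sqsubseteq> a" "b \<sqsubseteq> x2"
    using assms by (auto simp: p)
  have "complementary L (b \<squnion> x1) (a \<sqinter> x2)"
    using complementary_orthogonal_join[OF complementary_sym[OF ab] c le(2,1)] .
  then show ?thesis
    using assms complementaryD[OF c]
    by (simp add: p ocompl_interval complementary_sym meet_left join_left)
qed

text \<open>One of the two cancellation laws of the transposition between \<open>[b, 1]\<close> and \<open>[0, a]\<close>; the
  other is \<open>complementary_meet_join\<close>.\<close>

lemma transpose_back: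
  assumes "b \<sqsubseteq> x" "x \<in> carrier L"
  shows "(x \<sqinter> a) \<squnion> b = x"
  using complementary_join_meet[OF complementary_sym[OF ab] assms]
  by (simp add: join_comm[of L _ b] meet_comm[of L x])

lemma restrict_pair_closed:
  assumes "p \<in> carrier interval"
  shows "restrict_pair a p \<in> carrier (complementary_pairs (down L a))"
proof -
  note [simp] = complementaryD[OF ab]
  obtain x1 x2 where p: "p = (x1, x2)" by (cases p)
  have c: "complementary L x1 x2" and le: "x1 \<sqsubseteq> a"
    using assms by (auto simp: p)
  note [simp] = complementaryD[OF c]
  have "x1 \<sqinter> (x2 \<sqinter> a) = \<bottom>"
    using meet_assoc[of x1 x2 a] meet_absorb1[of "\<bottom>" a] by simp
  moreover have "x1 \<squnion> (x2 \<sqinter> a) = a"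
    using complementary_join_meet[OF c le] by simp
  ultimately show ?thesis
    using le by (simp add: p complementary_pairs_def complementary_down_iff meet_right)
qed

text \<open>Conversely, joining \<open>b\<close> to a complement relative to \<open>a\<close> keeps the meet with \<open>u \<sqsubseteq> a\<close> at \<open>0\<close>,
  since that meet depends only on \<open>(v \<squnion> b) \<sqinter> a = v\<close>.\<close>

lemma extend_pair_closed:
  assumes "complementary (down L a) u v"
  shows "(u, v \<squnion> b) \<in> carrier interval"
proof -
  note [simp] = complementaryD[OF ab]
  have uv [simp]: "u \<in> carrier L" "v \<in> carrier L" "u \<sqinter> v = \<bottom>" "u \<squnion> v = a"
    and le: "u \<sqsubseteq> a" "v \<sqsubseteq> a"
    using assms by (simp_all add: complementary_down_iff)
  have "u \<sqinter> (v \<squnion> b) = (u \<sqinter> a) \<sqinter> (v \<squnion> b)"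
    using le by (simp add: meet_absorb1)
  also have "\<dots> = u \<sqinter> ((v \<squnion> b) \<sqinter> a)"
    by (simp add: meet_assoc meet_comm[of L a])
  also have "\<dots> = \<bottom>"
    using complementary_meet_join[OF ab le(2)] by simp
  finally have "u \<sqinter> (v \<squnion> b) = \<bottom>" .
  moreover have "u \<squnion> (v \<squnion> b) = \<top>"
    using join_assoc[of u v b] by simp
  ultimately show ?thesis
    using le by (simp add: complementary_def join_right)
qed

lemma restrict_pair_bij:
  "bij_betw (restrict_pair a) (carrier interval) (carrier (complementary_pairs (down L a)))"
proof (rule bij_betw_byWitness[where f' = "\<lambda>(u, v). (u, v \<squnion> b)"])
  have a: "a \<in> carrier L" using complementaryD[OF ab] by simp
  show "\<forall>p\<in>carrier interval. (\<lambda>(u, v). (u, v \<squnion> b)) (restrict_pair a p) = p"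
    by (auto intro!: transpose_back dest: complementaryD)
  show "\<forall>q\<in>carrier (complementary_pairs (down L a)).
      restrict_pair a ((\<lambda>(u, v). (u, v \<squnion> b)) q) = q"
    using complementary_meet_join[OF ab]
    by (auto simp: complementary_pairs_def complementary_down_iff[OF a])
  show "restrict_pair a ` carrier interval \<subseteq> carrier (complementary_pairs (down L a))"
    using restrict_pair_closed by blast
  show "(\<lambda>(u, v). (u, v \<squnion> b)) ` carrier (complementary_pairs (down L a)) \<subseteq> carrier interval"
    using extend_pair_closed by (auto simp: complementary_pairs_def)
qed

lemma restrict_pair_le_iff:
  assumes "p \<in> carrier interval" "q \<in> carrier interval"
  shows "p \<sqsubseteq>\<^bsub>interval\<^esub> q \<longleftrightarrow>
    restrict_pair a p \<sqsubseteq>\<^bsub>complementary_pairs (down L a)\<^esub> restrict_pair a q"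
proof -
  obtain x1 x2 y1 y2 where pq: "p = (x1, x2)" "q = (y1, y2)" by (cases p; cases q)
  have x: "complementary L x1 x2" "b \<sqsubseteq> x2" and y: "complementary L y1 y2" "b \<sqsubseteq> y2"
    using assms by (auto simp: pq)
  note [simp] = complementaryD[OF ab] complementaryD[OF x(1)] complementaryD[OF y(1)]
  have "y2 \<sqsubseteq> x2 \<longleftrightarrow> y2 \<sqinter> a \<sqsubseteq> x2 \<sqinter> a"
  proof
    assume "y2 \<sqsubseteq> x2"
    then show "y2 \<sqinter> a \<sqsubseteq> x2 \<sqinter> a"
      using le_trans[OF meet_left, of y2 a x2] by (auto intro!: meet_le meet_right)
  next
    assume "y2 \<sqinter> a \<sqsubseteq> x2 \<sqinter> a"
    then have "(y2 \<sqinter> a) \<squnion> b \<sqsubseteq> (x2 \<sqinter> a) \<squnion> b"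
      using le_trans[OF _ join_left, of "y2 \<sqinter> a" "x2 \<sqinter> a" b] by (auto intro!: join_le join_right)
    then show "y2 \<sqsubseteq> x2"
      using x(2) y(2) by (simp add: transpose_back)
  qed
  then show ?thesis
    by (simp add: pq) (simp add: complementary_pairs_def)
qed

lemma restrict_pair_ocompl:
  assumes "p \<in> carrier interval"
  shows "restrict_pair a (\<sim>\<^bsub>interval\<^esub> p) = \<sim>\<^bsub>complementary_pairs (down L a)\<^esub> (restrict_pair a p)"
proof -
  obtain x1 x2 where p: "p = (x1, x2)" by (cases p)
  have c: "complementary L x1 x2" and le: "x1 \<sqsubseteq> a"
    using assms by (auto simp: p)
  have "(x1 \<squnion> b) \<sqinter> a = x1"
    using complementary_meet_join[OF ab le] complementaryD[OF c] by simp
  then show ?thesis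
    using ocompl_interval assms
    by (simp add: p join_comm[of L b] meet_comm[of L a])
      (simp add: complementary_pairs_def)
qed

theorem restrict_pair_omp_iso:
  "restrict_pair a \<in> omp_iso interval (complementary_pairs (down L a))"
proof -
  interpret D: bounded_modular_lattice "down L a"
    using complementaryD(1)[OF ab] by (rule bounded_modular_lattice_down)
  have "eq interval = (=)"
    by (simp add: omp_interval_def eq_pairs)
  then have "orthomodular_poset interval"
    by (rule orthomodular_poset_transport[OF D.complementary_pairs_orthomodular _
          restrict_pair_bij])
      (fact restrict_pair_le_iff ocompl_interval_closed restrict_pair_ocompl)+
  then show ?thesis
    using D.complementary_pairs_orthomodular restrict_pair_bij restrict_pair_le_iff
      restrict_pair_ocompl
    by (simp add: omp_iso_def)
qed

end

end

theorem theorem3p1: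
  fixes L :: "('a, 'c) gorder_scheme" and a b :: 'a
  assumes "bounded_modular_lattice L"
    and "complementary L a b"
  shows "omp_isomorphic (omp_interval (complementary_pairs L) (a, b))
           (complementary_pairs (down L a))"
  using bounded_modular_lattice.restrict_pair_omp_iso[OF assms]
  unfolding omp_isomorphic_def by blast

end
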